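(* Let $n>9$. Then \[N_n(1/2)\le\frac{N_9}{2^{81}}\prod_{k=10}^n\left(1-\frac{20}{2^k}+\frac{200}{2^{2k}}\right).\]
   Context: An $n\times n$ matrix is strongly non-singular if its leading $k\times k$ principal minor is non-zero (over $\mathbb{R}$) for every $k\in\{1,\dots,n\}$. $N_n(1/2)$ denotes the probability that a uniformly random matrix in $\{0,1\}^{n\times n}$ (independent entries, each $0$ or $1$ with probability $1/2$) is strongly non-singular. $N_9$ denotes the number of strongly non-singular matrices in $\{0,1\}^{9\times9}$. *)

theory Defs
  imports
    "HOL-Probability.Probability_Mass_Function"
    "Jordan_Normal_Form.Determinant"
    "Jordan_Normal_Form.DL_Submatrix"
begin

(* Matrix indices start at 0, so the leading k x k submatrix has row and column indices {..<k}. *)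
definition leading_principal_minor :: "'a::comm_ring_1 mat \<Rightarrow> nat \<Rightarrow> 'a" where
  "leading_principal_minor A k = Determinant.det (submatrix A {..<k} {..<k})"

definition strongly_nonsingular :: "'a::comm_ring_1 mat \<Rightarrow> bool" where
  "strongly_nonsingular A \<longleftrightarrow>
     square_mat A \<and> (\<forall>k\<in>{1..dim_row A}. leading_principal_minor A k \<noteq> 0)"

(* The entries are taken in the reals because non-singularity is meant over the reals,
   not over the two-element field. *)
definition binary_matrices :: "nat \<Rightarrow> real mat set" where
  "binary_matrices n = {A \<in> carrier_mat n n. elements_mat A \<subseteq> {0, 1}}"

definition num_strongly_nonsingular :: "nat \<Rightarrow> nat" where
  "num_strongly_nonsingular n = card {A \<in> binary_matrices n. strongly_nonsingular A}"

(* The uniform distribution on the set of all n x n matrices over {0, 1} is the distribution of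
   a matrix with independent entries, each 0 or 1 with probability 1/2. *)
definition prob_strongly_nonsingular :: "nat \<Rightarrow> real" where
  "prob_strongly_nonsingular n =
     measure_pmf.prob (pmf_of_set (binary_matrices n)) {A. strongly_nonsingular A}"

lemma submatrix_lessThan:
  assumes "A \<in> carrier_mat n m" "k \<le> n" "k \<le> m"
  shows "submatrix A {..<k} {..<k} = Matrix.mat k k (\<lambda>(i, j). A $$ (i, j))"
proof -
  have c: "card {i. i < d \<and> i < k} = k" if "k \<le> d" for d
  proof -
    have "{i. i < d \<and> i < k} = {..<k}" using that by auto
    then show ?thesis by simp
  qed
  have p: "pick {..<k} i = i" if "i < k" for i
    using pick_card_in_set[of i "{..<k}"] that
    by (metis (no_types, lifting) Collect_cong card_Collect_less_nat lessThan_iff order.strict_trans)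
  show ?thesis
    using assms by (intro eq_matI) (auto simp: submatrix_def c p)
qed

(* pmf_of_set is only meaningful on a finite non-empty set. *)
lemma finite_binary_matrices: "finite (binary_matrices n)"
proof (rule finite_subset)
  let ?I = "{..<n} \<times> {..<n}"
  show "finite (Matrix.mat n n ` (?I \<rightarrow>\<^sub>E {0, 1 :: real}))"
    by (intro finite_imageI finite_PiE) auto
  show "binary_matrices n \<subseteq> Matrix.mat n n ` (?I \<rightarrow>\<^sub>E {0, 1 :: real})"
  proof
    fix A assume "A \<in> binary_matrices n"
    then have A: "A \<in> carrier_mat n n" and e: "elements_mat A \<subseteq> {0, 1}"
      by (auto simp: binary_matrices_def)
    have "A $$ (i, j) \<in> {0, 1}" if "i < n" "j < n" for i j
      using A e that by (metis carrier_matD elements_matI subsetD)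
    then have "restrict (\<lambda>ij. A $$ ij) ?I \<in> ?I \<rightarrow>\<^sub>E {0, 1 :: real}"
      by auto
    moreover have "A = Matrix.mat n n (restrict (\<lambda>ij. A $$ ij) ?I)"
      using A by (intro eq_matI) auto
    ultimately show "A \<in> Matrix.mat n n ` (?I \<rightarrow>\<^sub>E {0, 1 :: real})" by blast
  qed
qed

lemma binary_matrices_nonempty: "binary_matrices n \<noteq> {}"
proof -
  have "0\<^sub>m n n \<in> binary_matrices n"
    by (auto simp: binary_matrices_def elements_mat_def)
  then show ?thesis by blast
qed

end

theory Submission
  imports Defs
begin

text \<open>
  Border a strongly non-singular \<open>m \<times> m\<close> matrix \<open>M\<close> by a column \<open>b\<close>, a row \<open>c\<close> and a corner \<open>d\<close>.
  If \<open>b\<close> is zero or a column of \<open>M\<close>, then every binary \<open>c\<close> admits a binary \<open>d\<close> making the bordered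
  matrix singular; the same holds with rows in place of columns. As \<open>M\<close> is non-singular, these are
  \<open>m + 1\<close> different choices of \<open>b\<close> and of \<open>c\<close>, and inclusion-exclusion gives at least
  \<open>2 (m + 1) 2^m - (m + 1)\<^sup>2\<close> singular borderings. For \<open>m \<ge> 9\<close> this is at least \<open>20 \<cdot> 2^m - 100\<close>,
  which is the factor for \<open>k = m + 1\<close>.
\<close>

text \<open>\<open>det_row_0\<close> speaks of matrices given by a family of rows, so
  \<open>A\<close> is first written as \<open>mat\<^sub>r\<close> with its row \<open>k\<close>
  replaced by the equal zero vector.\<close>

lemma det_zero_row:
  fixes A :: "'a::comm_ring_1 mat"
  assumes A: "A \<in> carrier_mat n n" and k: "k < n" and r: "row A k = 0\<^sub>v n"
  shows "Determinant.det A = 0"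
proof -
  have "A = mat\<^sub>r n n (\<lambda>i. if i = k then 0\<^sub>v n else row A i)"
  proof (rule eq_rowI)
    fix i assume "i < dim_row (mat\<^sub>r n n (\<lambda>i. if i = k then 0\<^sub>v n else row A i))"
    then show "row A i = row (mat\<^sub>r n n (\<lambda>i. if i = k then 0\<^sub>v n else row A i)) i"
      using A r by simp
  qed (use A in auto)
  moreover have "Determinant.det (mat\<^sub>r n n (\<lambda>i. if i = k then 0\<^sub>v n else row A i)) = 0"
    using A by (intro det_row_0 k) auto
  ultimately show ?thesis by simp
qed

section \<open>Counting binary vectors and binary matrices\<close>

definition binary_vecs :: "nat \<Rightarrow> real vec set" where
  "binary_vecs m = {v \<in> carrier_vec m. \<forall>i<m. v $ i \<in> {0, 1}}"

text \<open>\<open>vec m\<close> ignores the values of a function outside \<open>{..<m}\<close>;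
  restricting it to extensional functions makes it a bijection onto the binary vectors.\<close>

lemma card_binary_vecs: "card (binary_vecs m) = 2 ^ m"
proof -
  have "bij_betw (vec m) ({..<m} \<rightarrow>\<^sub>E {0, 1}) (binary_vecs m)"
    unfolding bij_betw_def
  proof
    show "inj_on (vec m) ({..<m} \<rightarrow>\<^sub>E {0, 1 :: real})"
    proof (rule inj_onI)
      fix f g :: "nat \<Rightarrow> real"
      assume fg: "f \<in> {..<m} \<rightarrow>\<^sub>E {0, 1}" "g \<in> {..<m} \<rightarrow>\<^sub>E {0, 1}" and eq: "vec m f = vec m g"
      show "f = g"
      proof (rule PiE_ext[OF fg])
        fix i assume "i \<in> {..<m}"
        then show "f i = g i" using arg_cong[OF eq, of "\<lambda>v. v $ i"] by simp
      qed
    qed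
    show "vec m ` ({..<m} \<rightarrow>\<^sub>E {0, 1}) = binary_vecs m"
    proof (intro equalityI subsetI)
      fix v assume v: "v \<in> binary_vecs m"
      show "v \<in> vec m ` ({..<m} \<rightarrow>\<^sub>E {0, 1})"
      proof (rule image_eqI)
        show "v = vec m (restrict (($) v) {..<m})"
          using v by (intro eq_vecI) (auto simp: binary_vecs_def)
        show "restrict (($) v) {..<m} \<in> {..<m} \<rightarrow>\<^sub>E {0, 1}"
          using v by (auto simp: binary_vecs_def)
      qed
    next
      fix v assume "v \<in> vec m ` ({..<m} \<rightarrow>\<^sub>E {0, 1 :: real})"
      then obtain f where f: "f \<in> {..<m} \<rightarrow>\<^sub>E {0, 1 :: real}" and v: "v = vec m f" by blast
      have "f i \<in> {0, 1}" if "i < m" for i using PiE_mem[OF f] that by simp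
      then show "v \<in> binary_vecs m" by (simp add: v binary_vecs_def)
    qed
  qed
  from bij_betw_same_card[OF this] show ?thesis by (simp add: card_funcsetE numeral_2_eq_2)
qed

text \<open>An infinite set would have \<open>card\<close> equal to 0, but a power of two is
  non-zero.\<close>

lemma finite_binary_vecs: "finite (binary_vecs m)"
  using card_binary_vecs[of m] by (metis card.infinite power_not_zero zero_neq_numeral)

lemma binary_matrices_iff:
  "A \<in> binary_matrices n \<longleftrightarrow> A \<in> carrier_mat n n \<and> (\<forall>i<n. \<forall>j<n. A $$ (i, j) \<in> {0, 1})"
  unfolding binary_matrices_def by (fastforce dest: elements_matD)

lemma card_binary_matrices: "card (binary_matrices n) = 2 ^ (n\<^sup>2)"
proof -
  let ?I = "{..<n} \<times> {..<n}"
  have "bij_betw (Matrix.mat n n) (?I \<rightarrow>\<^sub>E {0, 1}) (binary_matrices n)"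
    unfolding bij_betw_def
  proof
    show "inj_on (Matrix.mat n n) (?I \<rightarrow>\<^sub>E {0, 1 :: real})"
    proof (rule inj_onI)
      fix f g :: "nat \<times> nat \<Rightarrow> real"
      assume fg: "f \<in> ?I \<rightarrow>\<^sub>E {0, 1}" "g \<in> ?I \<rightarrow>\<^sub>E {0, 1}" and eq: "Matrix.mat n n f = Matrix.mat n n g"
      show "f = g"
      proof (rule PiE_ext[OF fg])
        fix ij assume "ij \<in> ?I"
        then show "f ij = g ij" using arg_cong[OF eq, of "\<lambda>A. A $$ ij"] by auto
      qed
    qed
    show "Matrix.mat n n ` (?I \<rightarrow>\<^sub>E {0, 1}) = binary_matrices n"
    proof (intro equalityI subsetI)
      fix A assume A: "A \<in> binary_matrices n"
      show "A \<in> Matrix.mat n n ` (?I \<rightarrow>\<^sub>E {0, 1})"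
      proof (rule image_eqI)
        show "A = Matrix.mat n n (restrict (($$) A) ?I)"
          using A by (intro eq_matI) (auto simp: binary_matrices_iff)
        show "restrict (($$) A) ?I \<in> ?I \<rightarrow>\<^sub>E {0, 1}"
          using A by (auto simp: binary_matrices_iff)
      qed
    next
      fix A assume "A \<in> Matrix.mat n n ` (?I \<rightarrow>\<^sub>E {0, 1 :: real})"
      then obtain f where f: "f \<in> ?I \<rightarrow>\<^sub>E {0, 1 :: real}" and A: "A = Matrix.mat n n f" by blast
      have "f (i, j) \<in> {0, 1}" if "i < n" "j < n" for i j using PiE_mem[OF f] that by simp
      then show "A \<in> binary_matrices n" by (simp add: A binary_matrices_iff)
    qed
  qed
  from bij_betw_same_card[OF this] show ?thesis
    by (simp add: card_funcsetE card_cartesian_product numeral_2_eq_2)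
qed

lemma binary_matrices_transpose: "A \<in> binary_matrices n \<Longrightarrow> A\<^sup>T \<in> binary_matrices n"
  unfolding binary_matrices_iff carrier_mat_def by simp

lemma prob_strongly_nonsingular_eq:
  "prob_strongly_nonsingular n = real (num_strongly_nonsingular n) / 2 ^ (n\<^sup>2)"
  unfolding prob_strongly_nonsingular_def num_strongly_nonsingular_def
  by (subst measure_pmf_of_set[OF binary_matrices_nonempty finite_binary_matrices])
    (auto simp: card_binary_matrices Int_def)

section \<open>Bordered matrices and their singular borders\<close>

definition bordered_mat :: "'a mat \<Rightarrow> 'a vec \<Rightarrow> 'a vec \<Rightarrow> 'a \<Rightarrow> 'a mat" where
  "bordered_mat M b c d = Matrix.mat (Suc (dim_row M)) (Suc (dim_col M)) (\<lambda>(i, j).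
     if i < dim_row M then if j < dim_col M then M $$ (i, j) else b $ i
     else if j < dim_col M then c $ j else d)"

text \<open>Transposition swaps the two borders, so each fact about the column \<open>b\<close>
  gives one about the row \<open>c\<close>.\<close>

lemma transpose_bordered_mat: "(bordered_mat M b c d)\<^sup>T = bordered_mat M\<^sup>T c b d"
  by (intro eq_matI) (auto simp: bordered_mat_def)

text \<open>The extra index \<open>dim_col M\<close> stands for the zero column.\<close>

definition col_or_zero :: "'a::zero mat \<Rightarrow> nat \<Rightarrow> 'a vec" where
  "col_or_zero M j = (if j < dim_col M then col M j else 0\<^sub>v (dim_row M))"

text \<open>The corner that goes with \<open>col_or_zero\<close>: below column \<open>j\<close> of
  \<open>M\<close> stands entry \<open>j\<close> of the new row, and below the zero column stands
  0.\<close>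

definition entry_or_zero :: "'a::zero vec \<Rightarrow> nat \<Rightarrow> 'a" where
  "entry_or_zero v j = (if j < dim_vec v then v $ j else 0)"

text \<open>The last column repeats column \<open>j\<close> if \<open>j < m\<close> and is zero
  otherwise. The determinant facts used concern rows, hence the passage to the transpose.\<close>

lemma det_bordered_mat_col_or_zero:
  fixes M :: "'a::comm_ring_1 mat"
  assumes M: "M \<in> carrier_mat m m" and c: "c \<in> carrier_vec m"
  shows "Determinant.det (bordered_mat M (col_or_zero M j) c (entry_or_zero c j)) = 0"
    (is "Determinant.det ?A = 0")
proof -
  have A: "?A \<in> carrier_mat (Suc m) (Suc m)" using M by (simp add: bordered_mat_def)
  show ?thesis
  proof (cases "j < m")
    case True
    have "col ?A j = col ?A m"
      using M c True
      by (intro eq_vecI) (auto simp: bordered_mat_def col_or_zero_def entry_or_zero_def)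
    then have "row ?A\<^sup>T j = row ?A\<^sup>T m" using M True by (simp add: bordered_mat_def)
    then have "Determinant.det ?A\<^sup>T = 0"
      using A True by (intro det_identical_rows[of _ "Suc m" j m]) auto
    then show ?thesis using det_transpose[OF A] by simp
  next
    case False
    have "row ?A\<^sup>T m = 0\<^sub>v (Suc m)"
      using M c False
      by (intro eq_vecI) (auto simp: bordered_mat_def col_or_zero_def entry_or_zero_def)
    then have "Determinant.det ?A\<^sup>T = 0"
      using A by (intro det_zero_row[of _ "Suc m" m]) auto
    then show ?thesis using det_transpose[OF A] by simp
  qed
qed

text \<open>Two equal columns, or a zero column, would force the determinant of \<open>M\<close> to
  vanish. The index \<open>m\<close> stands for the zero column, so there are \<open>m + 1\<close>
  distinct vectors.\<close>

lemma inj_on_col_or_zero: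
  fixes M :: "'a::comm_ring_1 mat"
  assumes M: "M \<in> carrier_mat m m" and det: "Determinant.det M \<noteq> 0"
  shows "inj_on (col_or_zero M) {..m}"
proof -
  have T: "M\<^sup>T \<in> carrier_mat m m" "Determinant.det M\<^sup>T \<noteq> 0"
    using M det det_transpose[OF M] by simp_all
  have nz: "col M j \<noteq> 0\<^sub>v m" if "j < m" for j
  proof
    assume "col M j = 0\<^sub>v m"
    then have "row M\<^sup>T j = 0\<^sub>v m" using M that by simp
    then show False using det_zero_row[OF T(1) that] T(2) by simp
  qed
  have ne: "i = j" if "i < m" "j < m" "col M i = col M j" for i j
  proof (rule ccontr)
    assume "i \<noteq> j"
    moreover have "row M\<^sup>T i = row M\<^sup>T j" using M that by simp
    ultimately show False using det_identical_rows[OF T(1), of i j] that(1,2) T(2) by simp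
  qed
  show ?thesis
  proof (rule inj_onI)
    fix i j assume ij: "i \<in> {..m}" "j \<in> {..m}" and eq: "col_or_zero M i = col_or_zero M j"
    consider "i < m" "j < m" | "i < m" "j = m" | "i = m" "j < m" | "i = m" "j = m"
      using ij by fastforce
    then show "i = j"
    proof cases
      case 1
      with eq M show ?thesis by (intro ne) (simp_all add: col_or_zero_def)
    next
      case 2
      with eq M nz[of i] show ?thesis by (simp add: col_or_zero_def)
    next
      case 3
      with eq M nz[of j] show ?thesis by (simp add: col_or_zero_def)
    qed simp
  qed
qed

lemma col_or_zero_binary:
  assumes "M \<in> binary_matrices m"
  shows "col_or_zero M j \<in> binary_vecs m"
proof (cases "j < m")
  case True
  have Mc: "M \<in> carrier_mat m m" and e: "\<forall>i<m. \<forall>j<m. M $$ (i, j) \<in> {0, 1}"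
    using assms unfolding binary_matrices_iff by blast+
  note M = carrier_matD[OF Mc]
  have "col_or_zero M j = col M j" using M True by (simp add: col_or_zero_def)
  moreover have "col M j \<in> carrier_vec m" using M(1) by auto
  moreover have "col M j $ i \<in> {0, 1}" if "i < m" for i
    using e[rule_format, OF that True] M True that by simp
  ultimately show ?thesis unfolding binary_vecs_def by simp
next
  case False
  moreover have "dim_row M = m" "dim_col M = m"
    using assms by (auto simp: binary_matrices_def)
  ultimately show ?thesis by (simp add: binary_vecs_def col_or_zero_def)
qed

lemma entry_or_zero_binary: "v \<in> binary_vecs m \<Longrightarrow> entry_or_zero v j \<in> {0, 1}"
  by (auto simp: binary_vecs_def entry_or_zero_def)

section \<open>Counting singular and non-singular borderings\<close>

text \<open>Inclusion-exclusion for two families of singular borderings, one from columns and one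
  from rows. The overlap bound is added on the right to avoid truncated subtraction on
  \<open>nat\<close>.\<close>

lemma card_singular_borderings:
  assumes M: "M \<in> binary_matrices m" and det: "Determinant.det M \<noteq> 0"
  shows "2 * (m + 1) * 2 ^ m \<le>
    card {(b, c, d). b \<in> binary_vecs m \<and> c \<in> binary_vecs m \<and> d \<in> {0, 1} \<and>
      Determinant.det (bordered_mat M b c d) = 0} + (m + 1)\<^sup>2"
    (is "_ \<le> card ?S + _")
proof -
  let ?J = "{..m} \<times> binary_vecs m"
  \<comment> \<open>In \<open>f\<close> the column is special and the row free; in \<open>g\<close>
    the roles are exchanged. In both, the corner is forced.\<close>
  define f :: "nat \<times> real vec \<Rightarrow> real vec \<times> real vec \<times> real"
    where "f = (\<lambda>(j, c). (col_or_zero M j, c, entry_or_zero c j))"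
  define g :: "nat \<times> real vec \<Rightarrow> real vec \<times> real vec \<times> real"
    where "g = (\<lambda>(j, b). (b, col_or_zero M\<^sup>T j, entry_or_zero b j))"
  have Mc: "M \<in> carrier_mat m m" using M by (simp add: binary_matrices_iff)
  note MT = binary_matrices_transpose[OF M]
  have MTc: "M\<^sup>T \<in> carrier_mat m m" using Mc by simp
  have detT: "Determinant.det M\<^sup>T \<noteq> 0" using det det_transpose[OF Mc] by simp
  have finS: "finite ?S"
    by (rule finite_subset[of _ "binary_vecs m \<times> binary_vecs m \<times> {0, 1}"])
      (auto simp: finite_binary_vecs)
  have carr: "v \<in> carrier_vec m" if "v \<in> binary_vecs m" for v
    using that by (simp add: binary_vecs_def)
  have fS: "f ` ?J \<subseteq> ?S"
  proof clarify
    fix j c b' c' d'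
    assume c: "c \<in> binary_vecs m" and eq: "(b', c', d') = f (j, c)"
    then show "b' \<in> binary_vecs m \<and> c' \<in> binary_vecs m \<and> d' \<in> {0, 1} \<and>
        Determinant.det (bordered_mat M b' c' d') = 0"
      using col_or_zero_binary[OF M] entry_or_zero_binary[OF c]
        det_bordered_mat_col_or_zero[OF Mc carr[OF c]] by (simp add: f_def)
  qed
  have gS: "g ` ?J \<subseteq> ?S"
  proof clarify
    fix j b b' c' d'
    assume b: "b \<in> binary_vecs m" and eq: "(b', c', d') = g (j, b)"
    let ?A = "bordered_mat M b (col_or_zero M\<^sup>T j) (entry_or_zero b j)"
    \<comment> \<open>The transpose borders \<open>M\<^sup>T\<close> by one of its own columns or
      zero, so the column case applies to it.\<close>
    have "Determinant.det ?A\<^sup>T = 0"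
      unfolding transpose_bordered_mat by (rule det_bordered_mat_col_or_zero[OF MTc carr[OF b]])
    moreover have "?A \<in> carrier_mat (Suc m) (Suc m)" using Mc by (simp add: bordered_mat_def)
    ultimately have "Determinant.det ?A = 0" using det_transpose by metis
    then show "b' \<in> binary_vecs m \<and> c' \<in> binary_vecs m \<and> d' \<in> {0, 1} \<and>
        Determinant.det (bordered_mat M b' c' d') = 0"
      using eq b col_or_zero_binary[OF MT] entry_or_zero_binary[OF b] by (simp add: g_def)
  qed
  have cf: "card (f ` ?J) = (m + 1) * 2 ^ m"
  proof -
    \<comment> \<open>The first component recovers \<open>j\<close>, since \<open>M\<close> is
      non-singular, and the second is \<open>c\<close> itself.\<close>
    have "inj_on f ?J"
      using inj_on_col_or_zero[OF Mc det] by (auto simp: f_def inj_on_def)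
    then show ?thesis by (simp add: card_image card_cartesian_product card_binary_vecs)
  qed
  have cg: "card (g ` ?J) = (m + 1) * 2 ^ m"
  proof -
    have "inj_on g ?J"
      using inj_on_col_or_zero[OF MTc detT] by (auto simp: g_def inj_on_def)
    then show ?thesis by (simp add: card_image card_cartesian_product card_binary_vecs)
  qed
  have "card (f ` ?J \<inter> g ` ?J) \<le> (m + 1)\<^sup>2"
  proof -
    \<comment> \<open>In a common triple both borders are special, and \<open>f\<close> fixes the
      corner, so a pair of indices determines the triple.\<close>
    have "f ` ?J \<inter> g ` ?J \<subseteq> (\<lambda>(i, j). f (i, col_or_zero M\<^sup>T j)) ` ({..m} \<times> {..m})"
      by (force simp: f_def g_def)
    then have "card (f ` ?J \<inter> g ` ?J) \<le> card ({..m} \<times> {..m})"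
      by (meson card_image_le card_mono finite_SigmaI finite_atMost finite_imageI le_trans)
    then show ?thesis by (simp add: card_cartesian_product power2_eq_square)
  qed
  moreover have "card (f ` ?J) + card (g ` ?J) = card (f ` ?J \<union> g ` ?J) + card (f ` ?J \<inter> g ` ?J)"
    by (intro card_Un_Int finite_imageI) (auto simp: finite_binary_vecs)
  moreover have "card (f ` ?J \<union> g ` ?J) \<le> card ?S"
    using fS gS by (intro card_mono finS) auto
  ultimately show ?thesis unfolding cf cg by simp
qed

text \<open>The complement of the singular borderings among all triples; the exponent
  \<open>2 * m + 1\<close> counts the entries of \<open>b\<close> and \<open>c\<close> and the
  corner.\<close>

lemma card_nonsingular_borderings:
  assumes M: "M \<in> binary_matrices m" and det: "Determinant.det M \<noteq> 0"
  shows "card {(b, c, d). b \<in> binary_vecs m \<and> c \<in> binary_vecs m \<and> d \<in> {0, 1} \<and>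
      Determinant.det (bordered_mat M b c d) \<noteq> 0} + 2 * (m + 1) * 2 ^ m
    \<le> 2 ^ (2 * m + 1) + (m + 1)\<^sup>2"
    (is "card ?N + _ \<le> _")
proof -
  let ?S = "{(b, c, d). b \<in> binary_vecs m \<and> c \<in> binary_vecs m \<and> d \<in> {0, 1} \<and>
      Determinant.det (bordered_mat M b c d) = 0}"
  let ?T = "binary_vecs m \<times> binary_vecs m \<times> {0, 1 :: real}"
  have "finite ?T" by (simp add: finite_binary_vecs)
  moreover have "?T = ?N \<union> ?S" "?N \<inter> ?S = {}" by auto
  ultimately have "card ?T = card ?N + card ?S"
    by (metis (no_types, lifting) card_Un_disjoint finite_Un)
  moreover have "card ?T = 2 ^ (2 * m + 1)"
    by (simp add: card_cartesian_product card_binary_vecs mult_2 power_add distrib_left)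
  ultimately show ?thesis using card_singular_borderings[OF M det] by linarith
qed

section \<open>Recursion in the size of the matrix\<close>

lemma strongly_nonsingular_iff:
  assumes "A \<in> carrier_mat n n"
  shows "strongly_nonsingular A \<longleftrightarrow>
    (\<forall>k\<in>{1..n}. Determinant.det (Matrix.mat k k (\<lambda>(i, j). A $$ (i, j))) \<noteq> 0)"
  using assms submatrix_lessThan[OF assms]
  by (auto simp: strongly_nonsingular_def leading_principal_minor_def)

text \<open>This is the minor of order \<open>n\<close>, except for \<open>n = 0\<close>: then no
  minor is tested, but the empty determinant is 1.\<close>

lemma strongly_nonsingular_det:
  assumes A: "A \<in> carrier_mat n n" and s: "strongly_nonsingular A"
  shows "Determinant.det A \<noteq> 0"
proof (cases "n = 0")
  case True
  then show ?thesis using A by (simp add: det_dim_zero)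
next
  case False
  moreover have "Matrix.mat n n (\<lambda>(i, j). A $$ (i, j)) = A" using A by (intro eq_matI) auto
  moreover have "n \<in> {1..n}" using False by simp
  ultimately show ?thesis using s unfolding strongly_nonsingular_iff[OF A] by metis
qed

text \<open>Every strongly non-singular matrix of size \<open>m + 1\<close> is a non-singular
  bordering of its leading block, which is strongly non-singular. For an upper bound it suffices
  that bordering is onto these matrices.\<close>

lemma num_strongly_nonsingular_Suc:
  "num_strongly_nonsingular (Suc m) + num_strongly_nonsingular m * (2 * (m + 1) * 2 ^ m)
    \<le> num_strongly_nonsingular m * (2 ^ (2 * m + 1) + (m + 1)\<^sup>2)"
proof -
  define SN where "SN n = {A \<in> binary_matrices n. strongly_nonsingular A}" for n
  define N where "N M = {(b, c, d). b \<in> binary_vecs m \<and> c \<in> binary_vecs m \<and> d \<in> {0, 1} \<and>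
      Determinant.det (bordered_mat M b c d) \<noteq> 0}" for M
  have finSN: "finite (SN n)" for n
    using finite_binary_matrices by (simp add: SN_def)
  have finN: "finite (N M)" for M
    by (rule finite_subset[of _ "binary_vecs m \<times> binary_vecs m \<times> {0, 1}"])
      (auto simp: N_def finite_binary_vecs)
  have "SN (Suc m) \<subseteq> (\<lambda>(M, b, c, d). bordered_mat M b c d) ` Sigma (SN m) N"
  proof
    fix A assume A: "A \<in> SN (Suc m)"
    then have Ab: "A \<in> binary_matrices (Suc m)" and As: "strongly_nonsingular A"
      and Ac: "A \<in> carrier_mat (Suc m) (Suc m)"
      by (auto simp: SN_def binary_matrices_iff)
    define M where "M = Matrix.mat m m (\<lambda>(i, j). A $$ (i, j))"
    define b where "b = vec m (\<lambda>i. A $$ (i, m))"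
    define c where "c = vec m (\<lambda>j. A $$ (m, j))"
    define d where "d = A $$ (m, m)"
    have Mc: "M \<in> carrier_mat m m" by (simp add: M_def)
    have eq: "A = bordered_mat M b c d"
      using Ac by (intro eq_matI)
        (auto simp: bordered_mat_def M_def b_def c_def d_def less_Suc_eq)
    \<comment> \<open>Up to order \<open>m\<close>, the leading blocks of \<open>M\<close> are those
      of \<open>A\<close>.\<close>
    have "Matrix.mat k k (\<lambda>(i, j). M $$ (i, j)) = Matrix.mat k k (\<lambda>(i, j). A $$ (i, j))"
      if "k \<le> m" for k
      using that by (intro eq_matI) (auto simp: M_def)
    then have "strongly_nonsingular M"
      using As by (auto simp: strongly_nonsingular_iff[OF Mc] strongly_nonsingular_iff[OF Ac])
    then have "M \<in> SN m" using Ab by (auto simp: SN_def binary_matrices_iff M_def)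
    moreover have "Determinant.det (bordered_mat M b c d) \<noteq> 0"
      using strongly_nonsingular_det[OF Ac As] unfolding eq .
    moreover have "b \<in> binary_vecs m" "c \<in> binary_vecs m" "d \<in> {0, 1}"
      using Ab by (simp_all add: binary_matrices_iff binary_vecs_def b_def c_def d_def)
    ultimately have "(M, b, c, d) \<in> Sigma (SN m) N" by (simp add: N_def)
    then show "A \<in> (\<lambda>(M, b, c, d). bordered_mat M b c d) ` Sigma (SN m) N"
      by (rule rev_image_eqI) (simp add: eq)
  qed
  then have "card (SN (Suc m)) \<le> card (Sigma (SN m) N)"
    by (meson card_image_le card_mono finSN finN finite_SigmaI finite_imageI le_trans)
  also have "\<dots> = (\<Sum>M\<in>SN m. card (N M))" using finSN finN by simp
  \<comment> \<open>The subtracted term is moved into the sum, so that the bound on borderings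
    applies to each \<open>M\<close> separately.\<close>
  finally have "card (SN (Suc m)) + card (SN m) * (2 * (m + 1) * 2 ^ m)
      \<le> (\<Sum>M\<in>SN m. card (N M) + 2 * (m + 1) * 2 ^ m)"
    by (simp add: sum.distrib)
  also have "\<dots> \<le> (\<Sum>M\<in>SN m. 2 ^ (2 * m + 1) + (m + 1)\<^sup>2)"
  proof (rule sum_mono)
    fix M assume "M \<in> SN m"
    then have M: "M \<in> binary_matrices m" and s: "strongly_nonsingular M"
      by (auto simp: SN_def)
    have "Determinant.det M \<noteq> 0"
      using M s by (intro strongly_nonsingular_det) (auto simp: binary_matrices_iff)
    then show "card (N M) + 2 * (m + 1) * 2 ^ m \<le> 2 ^ (2 * m + 1) + (m + 1)\<^sup>2"
      unfolding N_def by (rule card_nonsingular_borderings[OF M])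
  qed
  finally show ?thesis
    by (simp add: num_strongly_nonsingular_def SN_def)
qed

section \<open>From counts to probabilities\<close>

lemma prob_strongly_nonsingular_Suc:
  assumes m: "m \<ge> 9"
  shows "prob_strongly_nonsingular (Suc m)
    \<le> prob_strongly_nonsingular m * (1 - 20 / 2 ^ Suc m + 200 / 2 ^ (2 * Suc m))"
proof -
  define p x :: real where "p = 2 ^ m" and "x = real m + 1"
  define a a' where "a = real (num_strongly_nonsingular m)"
    and "a' = real (num_strongly_nonsingular (Suc m))"
  have p: "p > 0" by (simp add: p_def)
  have "Suc m + 10 \<le> 2 * 2 ^ m"
    using m by (induction rule: dec_induct) auto
  then have "real (Suc m + 10) \<le> real (2 * 2 ^ m)" by (rule of_nat_mono)
  then have xp: "x + 10 \<le> 2 * p" by (simp add: x_def p_def)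
  have "x \<ge> 10" using m by (simp add: x_def)
  \<comment> \<open>Expanding this product gives the next inequality. Its first factor vanishes at
    \<open>m = 9\<close>, which is the origin of the constants 20 and 100.\<close>
  with xp have "0 \<le> (x - 10) * (2 * p - x - 10)" by simp
  then have "20 * p - 100 \<le> 2 * x * p - x\<^sup>2"
    by (simp add: algebra_simps power2_eq_square)
  moreover have a: "a \<ge> 0" by (simp add: a_def)
  ultimately have "a * (20 * p - 100) \<le> a * (2 * x * p - x\<^sup>2)"
    by (intro mult_left_mono)
  moreover have "a' + a * (2 * x * p) \<le> a * (2 * p\<^sup>2 + x\<^sup>2)"
  proof -
    have "real (num_strongly_nonsingular (Suc m) + num_strongly_nonsingular m * (2 * (m + 1) * 2 ^ m))
      \<le> real (num_strongly_nonsingular m * (2 ^ (2 * m + 1) + (m + 1)\<^sup>2))"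
      using num_strongly_nonsingular_Suc by (rule of_nat_mono)
    moreover have "real (2 * (m + 1) * 2 ^ m) = 2 * x * p"
      by (simp add: x_def p_def algebra_simps)
    moreover have "real (2 ^ (2 * m + 1) + (m + 1)\<^sup>2) = 2 * p\<^sup>2 + x\<^sup>2"
    proof -
      have "(2 :: real) ^ (2 * m + 1) = 2 * p\<^sup>2"
        by (simp add: p_def power_even_eq)
      then show ?thesis by (simp add: x_def)
    qed
    \<comment> \<open>Only the outer sum and products are pushed through the cast, so that the two
      factors converted above still match.\<close>
    ultimately show ?thesis
      by (simp only: a_def a'_def of_nat_add[of "num_strongly_nonsingular (Suc m)"]
          of_nat_mult[of "num_strongly_nonsingular m"])
  qed
  ultimately have "a' \<le> a * (2 * p\<^sup>2 - 20 * p + 100)"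
    by (simp add: algebra_simps)
  \<comment> \<open>The divisor is the number of binary matrices of size \<open>m + 1\<close>, as
    \<open>(m + 1)\<^sup>2 = m\<^sup>2 + 2 * m + 1\<close>.\<close>
  then have "a' / (2 ^ (m\<^sup>2) * (2 * p\<^sup>2)) \<le> a * (2 * p\<^sup>2 - 20 * p + 100) / (2 ^ (m\<^sup>2) * (2 * p\<^sup>2))"
    using p by (intro divide_right_mono) auto
  also have "\<dots> = a / 2 ^ (m\<^sup>2) * ((2 * p\<^sup>2 - 20 * p + 100) / (2 * p\<^sup>2))"
    by simp
  \<comment> \<open>Here \<open>2 * p\<close> is \<open>2 ^ k\<close> for \<open>k = Suc m\<close>;
    writing the last term over its square doubles 100 to 200.\<close>
  also have "(2 * p\<^sup>2 - 20 * p + 100) / (2 * p\<^sup>2) = 1 - 20 / (2 * p) + 200 / (2 * p)\<^sup>2"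
    using p by (simp add: diff_divide_distrib add_divide_distrib power2_eq_square)
  also have "2 ^ (m\<^sup>2) * (2 * p\<^sup>2) = (2 :: real) ^ ((Suc m)\<^sup>2)"
    by (simp add: p_def power2_eq_square power_add)
  also have "(2 * p)\<^sup>2 = 2 ^ (2 * Suc m)"
    by (simp only: p_def power_even_eq power_Suc)
  also have "2 * p = 2 ^ Suc m" by (simp add: p_def)
  finally show ?thesis by (simp add: prob_strongly_nonsingular_eq a_def a'_def)
qed

theorem corollary5p2:
  fixes n :: nat
  assumes "n > 9"
  shows "prob_strongly_nonsingular n
           \<le> real (num_strongly_nonsingular 9) / 2 ^ 81
              * (\<Prod>k = 10..n. 1 - 20 / 2 ^ k + 200 / 2 ^ (2 * k))"
proof -
  define h :: "nat \<Rightarrow> real" where "h k = 1 - 20 / 2 ^ k + 200 / 2 ^ (2 * k)" for k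
  \<comment> \<open>Non-negativity allows the induction hypothesis to be multiplied by the next
    factor; it follows by completing the square.\<close>
  have h: "h k \<ge> 0" for k
  proof -
    have "h k = (1 - 10 / 2 ^ k)\<^sup>2 + 100 / 2 ^ (2 * k)"
      unfolding h_def power_even_eq power2_eq_square by (simp add: field_simps)
    then show ?thesis by simp
  qed
  have "9 \<le> n" using assms by simp
  then have "prob_strongly_nonsingular n \<le> prob_strongly_nonsingular 9 * (\<Prod>k = 10..n. h k)"
  \<comment> \<open>The induction starts at 9, where the product is empty and equality
    holds.\<close>
  proof (induction n rule: dec_induct)
    case (step m)
    have "prob_strongly_nonsingular (Suc m) \<le> prob_strongly_nonsingular m * h (Suc m)"
      using prob_strongly_nonsingular_Suc step.hyps by (simp add: h_def)
    also have "\<dots> \<le> prob_strongly_nonsingular 9 * (\<Prod>k = 10..m. h k) * h (Suc m)"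
      using step.IH h by (intro mult_right_mono)
    finally show ?case using step.hyps by (simp add: mult.assoc)
  qed simp
  then show ?thesis by (simp add: prob_strongly_nonsingular_eq h_def)
qed

end
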